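(* Let $n$ be a positive integer, let $a,b,c\in\mathbb{C}$, none of which equals zero or a negative integer, and put $s=c-a-b$. Let $$S_n(a,b;c)=\sum_{k=0}^{n-1}\frac{(a)_k(b)_k}{(c)_k\,k!},\qquad \omega_n=\frac{\Gamma(n+a)\Gamma(n+b)}{\Gamma(n)\Gamma(n+c)},\qquad \lambda_n=\frac{\Gamma(n+a)\Gamma(n+b)}{\Gamma(n)\Gamma(n+a+b)}.$$ (i) If $s\neq 0,\pm1,\pm2,\ldots$ and $c-a\neq 0,-1,-2,\ldots$, $c-b\neq 0,-1,-2,\ldots$, then $$S_n(a,b;c)=\frac{\Gamma(c)\Gamma(c-a-b)}{\Gamma(c-a)\Gamma(c-b)}-\frac{\omega_n\Gamma(c)}{s\,\Gamma(a)\Gamma(b)}\;{}_3F_2\left[\begin{array}{c}c-a,\;c-b,\;1\\ n+c,\;1+s\end{array};1\right].$$ (ii) If $s=0$ (that is, $c=a+b$), then $$S_n(a,b;a+b)=\frac{\lambda_n\Gamma(a+b)}{\Gamma(a)\Gamma(b)}\sum_{k=0}^\infty\frac{(a)_k(b)_k}{(n+a+b)_k\,k!}\,\bigl\{\psi(n+a+b+k)+\psi(1+k)-\psi(a+k)-\psi(b+k)\bigr\}.$$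
   Context: $\Gamma$ is the gamma function and $\psi(x)=\Gamma'(x)/\Gamma(x)$ is its logarithmic derivative. $(a)_k=\Gamma(a+k)/\Gamma(a)=a(a+1)\cdots(a+k-1)$ is the Pochhammer symbol, with $(a)_0=1$. The generalized hypergeometric series of unit argument is $${}_3F_2\left[\begin{array}{c}\alpha,\beta,\gamma\\ \delta,\epsilon\end{array};1\right]=\sum_{k=0}^\infty\frac{(\alpha)_k(\beta)_k(\gamma)_k}{(\delta)_k(\epsilon)_k\,k!}.$$ *)

theory Defs
  imports "HOL-Analysis.Analysis"
begin

definition hyp3F2_term ::
  "complex \<Rightarrow> complex \<Rightarrow> complex \<Rightarrow> complex \<Rightarrow> complex \<Rightarrow> nat \<Rightarrow> complex" where
  "hyp3F2_term \<alpha> \<beta> \<gamma> \<delta> \<epsilon> k =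
     (pochhammer \<alpha> k * pochhammer \<beta> k * pochhammer \<gamma> k) /
     (pochhammer \<delta> k * pochhammer \<epsilon> k * fact k)"

text \<open>
  The series at unit argument. The value is only meaningful where the terms are
  summable and neither lower parameter is a non-positive integer.
\<close>
definition hyp3F2 ::
  "complex \<Rightarrow> complex \<Rightarrow> complex \<Rightarrow> complex \<Rightarrow> complex \<Rightarrow> complex" where
  "hyp3F2 \<alpha> \<beta> \<gamma> \<delta> \<epsilon> = (\<Sum>k. hyp3F2_term \<alpha> \<beta> \<gamma> \<delta> \<epsilon> k)"

definition hyp_partial_sum :: "nat \<Rightarrow> complex \<Rightarrow> complex \<Rightarrow> complex \<Rightarrow> complex" where
  "hyp_partial_sum n a b c =
     (\<Sum>k<n. (pochhammer a k * pochhammer b k) / (pochhammer c k * fact k))"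

definition omega :: "nat \<Rightarrow> complex \<Rightarrow> complex \<Rightarrow> complex \<Rightarrow> complex" where
  "omega n a b c =
     (Gamma (of_nat n + a) * Gamma (of_nat n + b)) / (Gamma (of_nat n) * Gamma (of_nat n + c))"

definition lam :: "nat \<Rightarrow> complex \<Rightarrow> complex \<Rightarrow> complex" where
  "lam n a b =
     (Gamma (of_nat n + a) * Gamma (of_nat n + b)) /
     (Gamma (of_nat n) * Gamma (of_nat n + a + b))"

text \<open>
  \<^const>\<open>Digamma\<close> is the logarithmic derivative of \<^const>\<open>Gamma\<close> away from the poles
  (\<open>has_field_derivative_Gamma\<close>); the theorem evaluates it only there.
\<close>
definition digamma_term :: "nat \<Rightarrow> complex \<Rightarrow> complex \<Rightarrow> nat \<Rightarrow> complex" where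
  "digamma_term n a b k =
     (pochhammer a k * pochhammer b k) / (pochhammer (of_nat n + a + b) k * fact k) *
     (Digamma (of_nat n + a + b + of_nat k) + Digamma (1 + of_nat k)
        - Digamma (a + of_nat k) - Digamma (b + of_nat k))"

end

theory Submission
  imports Defs
begin

text \<open>
  Both expansions come from one contiguous relation between consecutive values of \<open>n\<close>. Let \<open>u(n)\<close> be
  the \<open>n\<close>-th summand \<open>(a)\<^sub>n (b)\<^sub>n / ((c)\<^sub>n n!)\<close> of the partial sum, and let \<open>t n k\<close> be the \<open>k\<close>-th term of
  the infinite series on the right. In each case there is an explicit \<open>v n k\<close> with

  \<open>n t n k - (n + a)(n + b)/(n + c) t (n + 1) k = v n k - v n (k + 1)\<close>,

  where \<open>v n 0\<close> is a constant \<open>\<sigma>\<close> not depending on \<open>n\<close>, \<open>v n k \<longlonglongrightarrow> 0\<close> as \<open>k \<longlonglongrightarrow> \<infinity>\<close> for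
  \<open>n \<ge> 1\<close>, and \<open>v 0 k\<close> has a limit \<open>L\<close>. Summing over \<open>k\<close> gives
  \<open>n F(n) - (n+a)(n+b)/(n+c) F(n+1) = \<sigma>\<close> for \<open>n \<ge> 1\<close> and \<open>\<sigma> - L\<close> for \<open>n = 0\<close>, where \<open>F(n)\<close> is the
  sum of the series. Since \<open>u(n) (n+a)(n+b)/(n+c) = (n+1) u(n+1)\<close>, multiplication by \<open>u(n) / \<sigma>\<close> and
  induction on \<open>n\<close> yield \<open>S(n) = L / \<sigma> - n u(n) F(n) / \<sigma>\<close>
  (\<open>hyp_partial_sum_eq_remainder\<close>); and \<open>n u(n)\<close> is \<open>\<omega>(n) \<Gamma>(c) / (\<Gamma>(a) \<Gamma>(b))\<close>.

  The induction can start at \<open>n = 0\<close>, where the series itself may diverge, because there its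
  coefficient vanishes. It also proves convergence of the series for each \<open>n \<ge> 1\<close>, so that no
  estimates of the terms are needed, and no condition on the real part of \<open>s\<close>.

  For \<open>s \<notin> \<int>\<close> one takes \<open>v n k = (s + k) t n k\<close>, so \<open>\<sigma> = s\<close>, and \<open>L\<close> is \<open>s\<close> times the Gamma quotient of
  Gauss's theorem. For \<open>s = 0\<close> one takes \<open>v n k = k h n k D n k - h n k\<close>, where \<open>h n k\<close> and \<open>D n k\<close> are
  the hypergeometric and the digamma factor of \<open>t n k\<close>; now \<open>\<sigma> = -1\<close>, and \<open>L = 0\<close> because
  \<open>D n k \<longlonglongrightarrow> 0\<close>.
\<close>

section \<open>Auxiliary facts on rising factorials and limits\<close>

lemma add_of_nat_notin_nonpos_Ints:
  fixes z :: complex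
  assumes "z \<notin> \<int>\<^sub>\<le>\<^sub>0"
  shows "of_nat n + z \<notin> \<int>\<^sub>\<le>\<^sub>0"
proof
  assume "of_nat n + z \<in> \<int>\<^sub>\<le>\<^sub>0"
  from nonpos_Ints_diff_Nats[OF this, of "of_nat n"] assms show False
    by simp
qed

lemma add_of_nat_neq_0:
  fixes z :: complex
  assumes "z \<notin> \<int>\<^sub>\<le>\<^sub>0"
  shows "of_nat n + z \<noteq> 0" "z + of_nat n \<noteq> 0"
  using add_of_nat_notin_nonpos_Ints[OF assms, of n] by (auto simp: add.commute)

lemma pochhammer_neq_0:
  fixes z :: complex
  assumes "z \<notin> \<int>\<^sub>\<le>\<^sub>0"
  shows "pochhammer z k \<noteq> 0"
  using assms pochhammer_eq_0_imp_nonpos_Int by blast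

lemma pochhammer_plus_one:
  fixes z :: complex
  assumes "z \<noteq> 0"
  shows "pochhammer (z + 1) k = pochhammer z k * (z + of_nat k) / z"
  using assms pochhammer_rec[of z k] pochhammer_Suc[of z k] by (simp add: field_simps)

lemma tendsto_divide_add_of_nat:
  fixes f :: "nat \<Rightarrow> complex"
  assumes "f \<longlonglongrightarrow> l"
  shows "(\<lambda>k. f k / (z + of_nat k)) \<longlonglongrightarrow> 0"
  using assms
  by (rule tendsto_divide_0[OF _ tendsto_add_filterlim_at_infinity[OF tendsto_const tendsto_of_nat]])

text \<open>
  Both parameter sums agree, so the powers of \<open>k\<close> in Euler's product formula for the four Gamma
  values cancel.
\<close>
lemma tendsto_pochhammer_quotient:
  fixes \<alpha> \<beta> \<gamma> \<delta> :: complex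
  assumes \<alpha>: "\<alpha> \<notin> \<int>\<^sub>\<le>\<^sub>0" and \<beta>: "\<beta> \<notin> \<int>\<^sub>\<le>\<^sub>0" and \<gamma>: "\<gamma> \<notin> \<int>\<^sub>\<le>\<^sub>0" and \<delta>: "\<delta> \<notin> \<int>\<^sub>\<le>\<^sub>0"
    and balanced: "\<alpha> + \<beta> = \<gamma> + \<delta>"
  shows "(\<lambda>k. pochhammer \<alpha> k * pochhammer \<beta> k / (pochhammer \<gamma> k * pochhammer \<delta> k))
           \<longlonglongrightarrow> Gamma \<gamma> * Gamma \<delta> / (Gamma \<alpha> * Gamma \<beta>)"
proof -
  have "(\<lambda>k. Gamma_series' \<gamma> k * Gamma_series' \<delta> k / (Gamma_series' \<alpha> k * Gamma_series' \<beta> k))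
          \<longlonglongrightarrow> Gamma \<gamma> * Gamma \<delta> / (Gamma \<alpha> * Gamma \<beta>)"
    using \<alpha> \<beta> by (intro tendsto_intros Gamma_series'_LIMSEQ) (auto simp: Gamma_eq_zero_iff)
  moreover have "Gamma_series' \<gamma> k * Gamma_series' \<delta> k / (Gamma_series' \<alpha> k * Gamma_series' \<beta> k)
      = pochhammer \<alpha> k * pochhammer \<beta> k / (pochhammer \<gamma> k * pochhammer \<delta> k)" for k
  proof -
    have "exp (\<gamma> * L) * exp (\<delta> * L) = exp (\<alpha> * L) * exp (\<beta> * L)" for L :: complex
      using balanced by (simp flip: exp_add distrib_right)
    then show ?thesis
      using pochhammer_neq_0[OF \<alpha>, of k] pochhammer_neq_0[OF \<beta>, of k]
        pochhammer_neq_0[OF \<gamma>, of k] pochhammer_neq_0[OF \<delta>, of k]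
      by (simp add: Gamma_series'_def divide_simps)
  qed
  ultimately show ?thesis
    by simp
qed

lemma Digamma_plus_of_nat_minus_ln_tendsto_0:
  fixes z :: complex
  assumes "z \<notin> \<int>\<^sub>\<le>\<^sub>0"
  shows "(\<lambda>k. Digamma (z + of_nat k) - of_real (ln (real k))) \<longlonglongrightarrow> 0"
proof -
  \<comment> \<open>By the recurrence, the claim is the defining limit of the digamma function at \<open>z\<close>.\<close>
  have eq: "Digamma (z + of_nat k) = Digamma z + (\<Sum>j<k. inverse (z + of_nat j))" for k
  proof (induction k)
    case (Suc k)
    then show ?case
      using Digamma_plus1[OF add_of_nat_neq_0(2)[OF assms, of k]]
      by (simp add: inverse_eq_divide add_ac)
  qed simp
  have "z \<noteq> 0"
    using assms by auto
  from tendsto_diff[OF tendsto_const Digamma_LIMSEQ[OF this], of "Digamma z"]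
  show ?thesis
    by (simp add: eq algebra_simps)
qed

section \<open>Summation by a contiguous relation\<close>

text \<open>
  Convergence is required of \<open>u * f\<close> only, not of \<open>f\<close>: the case \<open>u = 0\<close> with \<open>f\<close> divergent starts the
  induction below.
\<close>
lemma contiguous_sums:
  fixes f g v :: "nat \<Rightarrow> complex"
  assumes rel: "\<And>k. u * f k - K * g k = v k - v (Suc k)"
    and lim: "v \<longlonglongrightarrow> L" and K: "K \<noteq> 0"
    and f: "(\<lambda>k. u * f k) sums F"
  shows "g sums ((F - v 0 + L) / K)"
proof -
  have "(\<lambda>k. v k - v (Suc k)) sums (v 0 - L)"
    using telescope_sums'[OF lim] by simp
  from sums_divide[OF sums_diff[OF f this], of K]
  have "(\<lambda>k. (u * f k - (v k - v (Suc k))) / K) sums ((F - (v 0 - L)) / K)" .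
  moreover have "(u * f k - (v k - v (Suc k))) / K = g k" for k
    using K by (simp flip: rel)
  ultimately show ?thesis
    by (simp add: algebra_simps)
qed

text \<open>
  The \<open>k\<close>-th term of Gauss's hypergeometric series at unit argument, that is, the summand of
  \<^const>\<open>hyp_partial_sum\<close>.
\<close>
definition hyp2F1_term :: "complex \<Rightarrow> complex \<Rightarrow> complex \<Rightarrow> nat \<Rightarrow> complex" where
  "hyp2F1_term a b c k = pochhammer a k * pochhammer b k / (pochhammer c k * fact k)"

lemma hyp2F1_term_Suc:
  assumes "c \<notin> \<int>\<^sub>\<le>\<^sub>0"
  shows "of_nat (Suc n) * hyp2F1_term a b c (Suc n) =
    (of_nat n + a) * (of_nat n + b) / (of_nat n + c) * hyp2F1_term a b c n"
proof -
  have "(1 + of_nat n :: complex) \<noteq> 0"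
    by (metis of_nat_Suc of_nat_eq_0_iff old.nat.distinct(1))
  then show ?thesis
  using add_of_nat_neq_0[OF assms, of n] pochhammer_neq_0[OF assms, of n]
  by (simp add: hyp2F1_term_def pochhammer_Suc divide_simps) (simp add: algebra_simps)
qed

text \<open>
  The common core of both expansions: any family \<open>t\<close> that satisfies the contiguous relation with a
  telescoping right-hand side represents the remainder of the partial sum.
\<close>
lemma hyp_partial_sum_eq_remainder:
  fixes a b c \<sigma> L :: complex and t v :: "nat \<Rightarrow> nat \<Rightarrow> complex"
  assumes a: "a \<notin> \<int>\<^sub>\<le>\<^sub>0" and b: "b \<notin> \<int>\<^sub>\<le>\<^sub>0" and c: "c \<notin> \<int>\<^sub>\<le>\<^sub>0" and \<sigma>: "\<sigma> \<noteq> 0"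
    and rel: "\<And>n k. of_nat n * t n k
                - (of_nat n + a) * (of_nat n + b) / (of_nat n + c) * t (Suc n) k
                = v n k - v n (Suc k)"
    and v0: "\<And>n. v n 0 = \<sigma>"
    and lim0: "v 0 \<longlonglongrightarrow> L" and lim: "\<And>n. v (Suc n) \<longlonglongrightarrow> 0"
    and n: "n > 0"
  shows "summable (t n) \<and>
    hyp_partial_sum n a b c = L / \<sigma> - of_nat n * hyp2F1_term a b c n / \<sigma> * (\<Sum>k. t n k)"
  using n
proof (induction n rule: nat_induct_non_zero)
  define K where "K n = (of_nat n + a) * (of_nat n + b) / (of_nat n + c)" for n
  have K: "K n \<noteq> 0" for n
    using add_of_nat_neq_0[OF a, of n] add_of_nat_neq_0[OF b, of n] add_of_nat_neq_0[OF c, of n]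
    by (simp add: K_def)
  note rel' = rel[folded K_def]
  note Suc_term = hyp2F1_term_Suc[OF c, of _ a b, folded K_def]
  {
    case 1
    have "t 1 sums ((L - \<sigma>) / K 0)"
      using contiguous_sums[OF rel' lim0 K, of 0] by (simp add: v0)
    moreover have "hyp2F1_term a b c 1 = K 0"
      using Suc_term[of 0] by (simp add: hyp2F1_term_def)
    ultimately show ?case
      using K[of 0] \<sigma> by (auto simp: sums_iff hyp_partial_sum_def field_simps)
  next
    case (Suc n)
    obtain m where m: "n = Suc m"
      using Suc.hyps gr0_conv_Suc by auto
    have "(\<lambda>k. of_nat n * t n k) sums (of_nat n * (\<Sum>k. t n k))"
      using Suc.IH by (intro sums_mult summable_sums) simp
    from contiguous_sums[OF rel' lim[of m, folded m] K this]
    have sums: "t (Suc n) sums ((of_nat n * (\<Sum>k. t n k) - \<sigma>) / K n)"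
      by (simp add: v0)
    have "hyp_partial_sum (Suc n) a b c = hyp_partial_sum n a b c + hyp2F1_term a b c n"
      by (simp add: hyp_partial_sum_def hyp2F1_term_def)
    also have "\<dots> = L / \<sigma> - K n * hyp2F1_term a b c n / \<sigma>
        * ((of_nat n * (\<Sum>k. t n k) - \<sigma>) / K n)"
      unfolding conjunct2[OF Suc.IH] using K[of n] \<sigma> by (simp add: field_simps)
    finally show ?case
      using sums by (simp only: Suc_term sums_iff)
  }
qed

lemma omega_eq_hyp2F1_term:
  assumes a: "a \<notin> \<int>\<^sub>\<le>\<^sub>0" and b: "b \<notin> \<int>\<^sub>\<le>\<^sub>0" and c: "c \<notin> \<int>\<^sub>\<le>\<^sub>0" and n: "n > 0"
  shows "omega n a b c * Gamma c / (Gamma a * Gamma b) = of_nat n * hyp2F1_term a b c n"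
proof -
  obtain m where m: "n = Suc m"
    using n gr0_conv_Suc by auto
  have "Gamma (of_nat n) = (fact m :: complex)"
    using Gamma_fact[of m] by (simp add: m)
  moreover have "fact n = of_nat n * (fact m :: complex)" "of_nat n \<noteq> (0 :: complex)"
    unfolding m by (simp_all del: of_nat_Suc)
  ultimately show ?thesis
    using a b c add_of_nat_notin_nonpos_Ints[OF c, of n]
    by (simp add: omega_def hyp2F1_term_def pochhammer_Gamma Gamma_eq_zero_iff divide_simps add.commute)
qed

section \<open>The case of non-integral parametric excess\<close>

lemma hyp_partial_sum_nonintegral:
  fixes a b c s :: complex
  assumes a: "a \<notin> \<int>\<^sub>\<le>\<^sub>0" and b: "b \<notin> \<int>\<^sub>\<le>\<^sub>0" and c: "c \<notin> \<int>\<^sub>\<le>\<^sub>0"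
    and ca: "c - a \<notin> \<int>\<^sub>\<le>\<^sub>0" and cb: "c - b \<notin> \<int>\<^sub>\<le>\<^sub>0"
    and s: "s = c - a - b" "s \<notin> \<int>" and n: "n > 0"
  shows "summable (hyp3F2_term (c - a) (c - b) 1 (of_nat n + c) (1 + s)) \<and>
    hyp_partial_sum n a b c = Gamma c * Gamma s / (Gamma (c - a) * Gamma (c - b))
      - of_nat n * hyp2F1_term a b c n / s * hyp3F2 (c - a) (c - b) 1 (of_nat n + c) (1 + s)"
proof -
  have s': "s \<notin> \<int>\<^sub>\<le>\<^sub>0"
    using s not_in_Ints_imp_not_in_nonpos_Ints by blast
  then have s1: "s + 1 \<notin> \<int>\<^sub>\<le>\<^sub>0"
    using plus_one_in_nonpos_Ints_imp by blast
  have s0: "s \<noteq> 0"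
    using s' by auto
  define t where "t = (\<lambda>n. hyp3F2_term (c - a) (c - b) 1 (of_nat n + c) (1 + s))"
  \<comment> \<open>The telescoping certificate. At \<open>n = 0\<close> the factor \<open>s + k\<close> turns \<open>1 / (1 + s)\<^sub>k\<close> into
    \<open>s / (s)\<^sub>k\<close> and makes the quotient balanced.\<close>
  define v where "v n k = (s + of_nat k) * t n k" for n k
  have t_eq: "t n k = pochhammer (c - a) k * pochhammer (c - b) k
      / (pochhammer (of_nat n + c) k * pochhammer (s + 1) k)" for n k
    by (simp add: t_def hyp3F2_term_def add.commute flip: pochhammer_fact)
  have t_Suc: "t (Suc n) k = t n k * (of_nat n + c) / (of_nat n + c + of_nat k)" for n k
  proof -
    have "of_nat (Suc n) + c = (of_nat n + c) + 1"
      by simp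
    then show ?thesis
      by (simp only: t_eq pochhammer_plus_one[OF add_of_nat_neq_0(1)[OF c, of n]])
        (simp add: mult_ac)
  qed
  have v_Suc: "v n (Suc k) = t n k * ((c - a + of_nat k) * (c - b + of_nat k))
      / (of_nat n + c + of_nat k)" for n k
    using add_of_nat_neq_0(2)[OF s1, of k]
    by (simp add: v_def t_eq pochhammer_Suc add_ac mult_ac)
  have rel: "of_nat n * t n k - (of_nat n + a) * (of_nat n + b) / (of_nat n + c) * t (Suc n) k
      = v n k - v n (Suc k)" for n k
  proof -
    define N X where "N = of_nat n + c" and "X = of_nat n + c + of_nat k"
    have "N \<noteq> 0" "X \<noteq> 0"
      using add_of_nat_neq_0(1)[OF c, of n] add_of_nat_neq_0(1)[OF c, of "n + k"]
      by (simp_all add: N_def X_def add_ac)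
    then have "of_nat n * t n k - (of_nat n + a) * (of_nat n + b) / N * (t n k * N / X)
       - ((s + of_nat k) * t n k - t n k * ((c - a + of_nat k) * (c - b + of_nat k)) / X)
      = t n k * (of_nat n * X - (of_nat n + a) * (of_nat n + b) - (s + of_nat k) * X
          + (c - a + of_nat k) * (c - b + of_nat k)) / X"
      by (simp add: field_simps)
    also have "of_nat n * X - (of_nat n + a) * (of_nat n + b) - (s + of_nat k) * X
          + (c - a + of_nat k) * (c - b + of_nat k) = 0"
      by (simp add: X_def s(1) algebra_simps)
    finally show ?thesis
      unfolding t_Suc v_Suc by (simp add: v_def N_def X_def)
  qed
  have v0: "v n 0 = s" for n
    by (simp add: v_def t_eq)
  have balanced: "(c - a) + (c - b) = c + s"
    by (simp add: s(1))
  have "v 0 k = s * (pochhammer (c - a) k * pochhammer (c - b) k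
      / (pochhammer c k * pochhammer s k))" for k
    using s0 add_of_nat_neq_0(2)[OF s', of k] by (simp add: v_def t_eq pochhammer_plus_one)
  then have "v 0 = (\<lambda>k. s * (pochhammer (c - a) k * pochhammer (c - b) k
      / (pochhammer c k * pochhammer s k)))" by blast
  then have lim0: "v 0 \<longlonglongrightarrow> s * (Gamma c * Gamma s / (Gamma (c - a) * Gamma (c - b)))"
    by (simp only: tendsto_mult_left[OF tendsto_pochhammer_quotient[OF ca cb c s' balanced]])
  have v_step: "v (Suc n) = (\<lambda>k. v n k * (of_nat n + c) / (of_nat n + c + of_nat k))" for n
    by (simp add: v_def t_Suc fun_eq_iff)
  have lim: "v (Suc n) \<longlonglongrightarrow> 0" for n
  proof (induction n)
    case 0
    show ?case
      unfolding v_step[of 0] by (rule tendsto_divide_add_of_nat[OF tendsto_mult_right[OF lim0]])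
  next
    case (Suc n)
    show ?case
      unfolding v_step[of "Suc n"] by (rule tendsto_divide_add_of_nat[OF tendsto_mult_right[OF Suc]])
  qed
  show ?thesis
    using hyp_partial_sum_eq_remainder[OF a b c s0 rel v0 lim0 lim n] s0
    by (simp add: t_def hyp3F2_def)
qed

section \<open>The case of zero parametric excess\<close>

lemma hyp_partial_sum_zero_excess:
  fixes a b :: complex
  assumes a: "a \<notin> \<int>\<^sub>\<le>\<^sub>0" and b: "b \<notin> \<int>\<^sub>\<le>\<^sub>0" and ab: "a + b \<notin> \<int>\<^sub>\<le>\<^sub>0" and n: "n > 0"
  shows "summable (digamma_term n a b) \<and>
    hyp_partial_sum n a b (a + b)
      = of_nat n * hyp2F1_term a b (a + b) n * (\<Sum>k. digamma_term n a b k)"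
proof -
  define c where "c = a + b"
  have c: "c \<notin> \<int>\<^sub>\<le>\<^sub>0"
    using ab by (simp add: c_def)
  define h where "h n k = hyp2F1_term a b (of_nat n + c) k" for n k
  define D where "D n k = Digamma (of_nat n + c + of_nat k) + Digamma (1 + of_nat k)
      - Digamma (a + of_nat k) - Digamma (b + of_nat k)" for n k
  define t where "t = (\<lambda>n k. h n k * D n k)"
  \<comment> \<open>The differences of \<open>k * h n k\<close> telescope the part that carries \<open>D\<close>; the rest, which comes
    from the increments of \<open>D\<close> in \<open>n\<close> and in \<open>k\<close>, is up to sign the difference
    \<open>h n (k + 1) - h n k\<close>.\<close>
  define v where "v n k = of_nat k * h n k * D n k - h n k" for n k
  have t_eq: "t n = digamma_term n a b" for n
    by (simp add: t_def h_def D_def digamma_term_def hyp2F1_term_def c_def add.assoc fun_eq_iff)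
  have h_lower: "h (Suc n) k = h n k * (of_nat n + c) / (of_nat n + c + of_nat k)" for n k
  proof -
    have "of_nat (Suc n) + c = (of_nat n + c) + 1"
      by simp
    then show ?thesis
      by (simp only: h_def hyp2F1_term_def pochhammer_plus_one[OF add_of_nat_neq_0(1)[OF c, of n]])
        (simp add: mult_ac)
  qed
  have h_Suc: "of_nat (Suc k) * h n (Suc k)
      = h n k * ((a + of_nat k) * (b + of_nat k)) / (of_nat n + c + of_nat k)" for n k
    using hyp2F1_term_Suc[OF add_of_nat_notin_nonpos_Ints[OF c], of k a b n]
    by (simp only: h_def) (simp add: add_ac mult_ac)
  have D_lower: "D (Suc n) k = D n k + 1 / (of_nat n + c + of_nat k)" for n k
    using Digamma_plus1[OF add_of_nat_neq_0(1)[OF c, of "n + k"]]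
    by (simp add: D_def add_ac)
  have D_Suc: "D n (Suc k) = D n k + 1 / (of_nat n + c + of_nat k) + 1 / (1 + of_nat k)
      - 1 / (a + of_nat k) - 1 / (b + of_nat k)" for n k
    using Digamma_plus1[OF add_of_nat_neq_0(1)[OF c, of "n + k"]]
      Digamma_plus1[OF add_of_nat_neq_0(1)[OF one_notin_nonpos_Ints, of k]]
      Digamma_plus1[OF add_of_nat_neq_0(2)[OF a, of k]]
      Digamma_plus1[OF add_of_nat_neq_0(2)[OF b, of k]]
    by (simp add: D_def add_ac)
  have rel: "of_nat n * t n k - (of_nat n + a) * (of_nat n + b) / (of_nat n + c) * t (Suc n) k
      = v n k - v n (Suc k)" for n k
  proof -
    define N X Y A B \<nu> \<kappa> where "N = of_nat n + c" and "X = of_nat n + c + of_nat k"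
      and "Y = 1 + (of_nat k :: complex)" and "A = a + of_nat k" and "B = b + of_nat k"
      and "\<nu> = (of_nat n :: complex)" and "\<kappa> = (of_nat k :: complex)"
    note defs = N_def X_def Y_def A_def B_def \<nu>_def \<kappa>_def
    have nz: "N \<noteq> 0" "X \<noteq> 0" "A \<noteq> 0" "B \<noteq> 0" "Y \<noteq> 0"
      using add_of_nat_neq_0(1)[OF c, of n] add_of_nat_neq_0(1)[OF c, of "n + k"]
        add_of_nat_neq_0(2)[OF a, of k] add_of_nat_neq_0(2)[OF b, of k]
        add_of_nat_neq_0(2)[OF one_notin_nonpos_Ints, of k]
      by (simp_all add: defs add_ac)
    have YH: "Y * h n (Suc k) = h n k * (A * B) / X"
      using h_Suc[of k n] by (simp add: defs)
    then have H: "h n (Suc k) = h n k * (A * B) / (X * Y)"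
      using nz by (simp add: field_simps)
    have DS: "D n (Suc k) = D n k + 1 / X + 1 / Y - 1 / A - 1 / B"
      using D_Suc[of n k] by (simp add: defs)
    have tS: "t (Suc n) k = h n k * N / X * (D n k + 1 / X)"
      by (simp add: t_def h_lower D_lower defs)
    have vS: "v n (Suc k) = h n k * (A * B) / X * (D n k + 1 / X + 1 / Y - 1 / A - 1 / B)
        - h n k * (A * B) / (X * Y)"
      by (simp add: v_def H DS flip: YH Y_def)
    have X: "\<nu> + a = X - B" "\<nu> + b = X - A" "\<nu> = X + \<kappa> - A - B"
      by (simp_all add: defs c_def algebra_simps)
    have "\<nu> * (h n k * D n k) - (X - B) * (X - A) / N * (h n k * N / X * (D n k + 1 / X))
      = (\<kappa> * h n k * D n k - h n k)
        - (h n k * (A * B) / X * (D n k + 1 / X + 1 / Y - 1 / A - 1 / B)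
        - h n k * (A * B) / (X * Y))"
      unfolding X(3) using nz by (simp add: divide_simps) (simp add: algebra_simps)
    then have "\<nu> * t n k - (\<nu> + a) * (\<nu> + b) / N * t (Suc n) k = v n k - v n (Suc k)"
      unfolding tS vS by (simp only: t_def v_def X(1,2) \<kappa>_def)
    then show ?thesis
      by (simp only: N_def \<nu>_def)
  qed
  have v0: "v n 0 = -1" for n
    by (simp add: v_def h_def hyp2F1_term_def)
  have D_lim: "D n \<longlonglongrightarrow> 0" for n
  proof -
    note lim = Digamma_plus_of_nat_minus_ln_tendsto_0
    from tendsto_diff[OF tendsto_diff[OF tendsto_add[OF
          lim[OF add_of_nat_notin_nonpos_Ints[OF c, of n]] lim[OF one_notin_nonpos_Ints]]
          lim[OF a]] lim[OF b]]
    show ?thesis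
      by (simp add: D_def[abs_def] algebra_simps)
  qed
  \<comment> \<open>After shifting the index, \<open>k * h 0 k\<close> is a multiple of the balanced quotient with upper
    parameters \<open>a + 1, b + 1\<close> and lower parameters \<open>c + 1, 1\<close>.\<close>
  have kh0: "\<exists>l. (\<lambda>k. of_nat k * h 0 k) \<longlonglongrightarrow> l"
  proof -
    let ?q = "\<lambda>k. pochhammer (a + 1) k * pochhammer (b + 1) k / (pochhammer (c + 1) k * pochhammer 1 k)"
    have "?q \<longlonglongrightarrow> Gamma (c + 1) * Gamma 1 / (Gamma (a + 1) * Gamma (b + 1))"
      using a b c plus_one_in_nonpos_Ints_imp
      by (intro tendsto_pochhammer_quotient) (auto simp: c_def)
    moreover have "of_nat (Suc k) * h 0 (Suc k) = a * b / c * ?q k" for k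
      using add_of_nat_neq_0(2)[OF a, of 0] add_of_nat_neq_0(2)[OF b, of 0]
        add_of_nat_neq_0(2)[OF c, of 0]
      unfolding h_Suc
      by (simp add: h_def hyp2F1_term_def pochhammer_plus_one pochhammer_fact mult_ac)
    ultimately have "(\<lambda>k. of_nat (Suc k) * h 0 (Suc k)) \<longlonglongrightarrow>
        a * b / c * (Gamma (c + 1) * Gamma 1 / (Gamma (a + 1) * Gamma (b + 1)))"
      by (simp only: tendsto_mult_left)
    then show ?thesis
      by (blast intro: LIMSEQ_imp_Suc)
  qed
  have kh: "\<exists>l. (\<lambda>k. of_nat k * h n k) \<longlonglongrightarrow> l" for n
  proof (induction n)
    case 0
    show ?case
      by (fact kh0)
  next
    case (Suc n)
    then obtain l where "(\<lambda>k. of_nat k * h n k) \<longlonglongrightarrow> l"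
      by blast
    from tendsto_divide_add_of_nat[OF tendsto_mult_right[OF this], of "of_nat n + c" "of_nat n + c"]
    show ?case
      by (auto simp: h_lower mult.assoc)
  qed
  have lim: "v n \<longlonglongrightarrow> 0" for n
  proof -
    from kh obtain l where l: "(\<lambda>k. of_nat k * h n k) \<longlonglongrightarrow> l"
      by blast
    have "(\<lambda>k. of_nat k * h n k / (0 + of_nat k)) \<longlonglongrightarrow> 0"
      by (rule tendsto_divide_add_of_nat[OF l])
    then have "h n \<longlonglongrightarrow> 0"
      by (rule Lim_transform_eventually) (rule eventually_mono[OF eventually_gt_at_top[of 0]], simp)
    from tendsto_diff[OF tendsto_mult[OF l D_lim] this] show ?thesis
      by (simp add: v_def[abs_def])
  qed
  show ?thesis
    using hyp_partial_sum_eq_remainder[OF a b c _ rel v0 lim lim n]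
    by (simp add: t_eq c_def)
qed

theorem theorem1:
  fixes n :: nat and a b c s :: complex
  assumes "n > 0"
    and "a \<notin> \<int>\<^sub>\<le>\<^sub>0" and "b \<notin> \<int>\<^sub>\<le>\<^sub>0" and "c \<notin> \<int>\<^sub>\<le>\<^sub>0"
    and "s = c - a - b"
  shows "(s \<notin> \<int> \<and> c - a \<notin> \<int>\<^sub>\<le>\<^sub>0 \<and> c - b \<notin> \<int>\<^sub>\<le>\<^sub>0 \<longrightarrow>
            summable (hyp3F2_term (c - a) (c - b) 1 (of_nat n + c) (1 + s)) \<and>
            hyp_partial_sum n a b c =
              (Gamma c * Gamma (c - a - b)) / (Gamma (c - a) * Gamma (c - b))
              - (omega n a b c * Gamma c) / (s * Gamma a * Gamma b)
                * hyp3F2 (c - a) (c - b) 1 (of_nat n + c) (1 + s))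
       \<and> (s = 0 \<longrightarrow>
            summable (digamma_term n a b) \<and>
            hyp_partial_sum n a b (a + b) =
              (lam n a b * Gamma (a + b)) / (Gamma a * Gamma b)
                * (\<Sum>k. digamma_term n a b k))"
proof (intro conjI[of "_ \<longrightarrow> _"] impI)
  assume "s \<notin> \<int> \<and> c - a \<notin> \<int>\<^sub>\<le>\<^sub>0 \<and> c - b \<notin> \<int>\<^sub>\<le>\<^sub>0"
  moreover have "(omega n a b c * Gamma c) / (s * Gamma a * Gamma b)
      = of_nat n * hyp2F1_term a b c n / s"
    by (simp add: mult_ac flip: omega_eq_hyp2F1_term[OF assms(2-4,1)])
  ultimately show "summable (hyp3F2_term (c - a) (c - b) 1 (of_nat n + c) (1 + s)) \<and>
      hyp_partial_sum n a b c =
        (Gamma c * Gamma (c - a - b)) / (Gamma (c - a) * Gamma (c - b))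
        - (omega n a b c * Gamma c) / (s * Gamma a * Gamma b)
          * hyp3F2 (c - a) (c - b) 1 (of_nat n + c) (1 + s)"
    using hyp_partial_sum_nonintegral[OF assms(2-4) _ _ assms(5) _ assms(1)] assms(5) by simp
next
  assume "s = 0"
  then have c: "c = a + b"
    using assms(5) by (simp add: algebra_simps)
  have "lam n a b = omega n a b (a + b)"
    by (simp add: lam_def omega_def add.assoc)
  then show "summable (digamma_term n a b) \<and>
      hyp_partial_sum n a b (a + b) =
        (lam n a b * Gamma (a + b)) / (Gamma a * Gamma b) * (\<Sum>k. digamma_term n a b k)"
    using hyp_partial_sum_zero_excess[OF assms(2,3) assms(4)[unfolded c] assms(1)]
      omega_eq_hyp2F1_term[OF assms(2,3) assms(4)[unfolded c] assms(1)] by simp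
qed

end
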